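(* Let $E\subset\mathbb{C}^d$ be a set and let $\Delta$ be an $s\times r$ matrix of complex-valued functions on $E$ such that $B_\Delta$ has more than one point. If $f\in S_{2,gen}(B_\Delta)$ and $z,w\in B_\Delta$, then $$d_{\mathbb{D}}(f(z),f(w))\le d_\Delta(z,w).$$
   Context: $B_\Delta:=\{z\in E : \|\Delta(z)\|<1\}$, with the operator norm on $B(\mathbb{C}^r,\mathbb{C}^s)$. No regularity of $\Delta$ is assumed. For $z,w\in B_\Delta$, $$d_\Delta(z,w):=\left\|(I-\Delta(w)\Delta(w)^* )^{-1/2}(\Delta(z)-\Delta(w))(I-\Delta(w)^*\Delta(z))^{-1}(I-\Delta(w)^*\Delta(w))^{1/2}\right\|.$$ With $\mathbb{D}$ the open unit disk, $d_{\mathbb{D}}(\alpha,\beta)=\left|\frac{\alpha-\beta}{1-\overline{\beta}\alpha}\right|$ for $\alpha,\beta$ in the closed unit disk whenever the denominator is nonzero, and $d_{\mathbb{D}}(\alpha,\alpha)=0$ if $|\alpha|=1$. A commuting $d$-tuple $T=(T^1,\dots,T^d)$ of operators on $\mathbb{C}^2$ is generic if there are linearly independent $v_1,v_2\in\mathbb{C}^2$ and distinct points $z_1,z_2\in\mathbb{C}^d$, $z_j=(z_j^1,\dots,z_j^d)$, with $T^k v_j=z_j^k v_j$ for all $1\le k\le d$, $j=1,2$; then $\sigma(T)=\{z_1,z_2\}$. For a function $f$ on $\sigma(T)$, $f(T)$ is the operator on $\mathbb{C}^2$ with $f(T)v_j=f(z_j)v_j$, and $\Delta(T)\in B(\mathbb{C}^r\otimes\mathbb{C}^2,\mathbb{C}^s\otimes\mathbb{C}^2)$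 is the operator with $\Delta(T)(e\otimes v_j)=\Delta(z_j)e\otimes v_j$ for $e\in\mathbb{C}^r$, $j=1,2$. $S_{2,gen}(B_\Delta)$ is the set of all functions $f:B_\Delta\to\mathbb{C}$ such that $\|f(T)\|\le 1$ for every generic $T$ on $\mathbb{C}^2$ with $\sigma(T)\subset B_\Delta$ and $\|\Delta(T)\|\le 1$. *)

theory Defs
  imports "HOL-Analysis.Analysis"
begin

text \<open>
  An \<open>s \<times> r\<close> complex matrix is a \<^typ>\<open>complex^'r^'s\<close> and acts on column vectors by
  \<open>(*v)\<close>. The library norm on \<^typ>\<open>complex^'n\<close> is the Euclidean (Hilbert space) norm, so
  the operator norm is \<^const>\<open>onorm\<close> of this action. (The library's \<^const>\<open>norm\<close> of a
  matrix is the Frobenius norm, which is not what is meant here.)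
\<close>

definition opnorm :: "complex^'n^'m \<Rightarrow> real" where
  "opnorm A = onorm (\<lambda>x. A *v x)"

definition conj_transpose :: "complex^'n^'m \<Rightarrow> complex^'m^'n" where
  "conj_transpose A = (\<chi> i j. cnj (A $ j $ i))"

definition positive_semidef :: "complex^'n^'n \<Rightarrow> bool" where
  "positive_semidef A \<longleftrightarrow> conj_transpose A = A \<and>
     (\<forall>x. 0 \<le> Re (\<Sum>i\<in>UNIV. (A *v x) $ i * cnj (x $ i)))"

definition mat_sqrt :: "complex^'n^'n \<Rightarrow> complex^'n^'n" where
  "mat_sqrt A = (THE P. positive_semidef P \<and> P ** P = A)"

definition B_Delta :: "(complex^'d) set \<Rightarrow> (complex^'d \<Rightarrow> complex^'r^'s) \<Rightarrow> (complex^'d) set" where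
  "B_Delta E \<Delta> = {z \<in> E. opnorm (\<Delta> z) < 1}"

definition d_Delta :: "(complex^'d \<Rightarrow> complex^'r^'s) \<Rightarrow> complex^'d \<Rightarrow> complex^'d \<Rightarrow> real" where
  "d_Delta \<Delta> z w = opnorm
     (matrix_inv (mat_sqrt (mat 1 - \<Delta> w ** conj_transpose (\<Delta> w)))
      ** (\<Delta> z - \<Delta> w)
      ** matrix_inv (mat 1 - conj_transpose (\<Delta> w) ** \<Delta> z)
      ** mat_sqrt (mat 1 - conj_transpose (\<Delta> w) ** \<Delta> w))"

text \<open>
  Meaningful on the closed unit disk, where \<open>1 - cnj \<beta> * \<alpha> = 0\<close> only if
  \<open>\<alpha> = \<beta>\<close> and \<open>\<bar>\<alpha>\<bar> = 1\<close>.
\<close>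

definition d_disk :: "complex \<Rightarrow> complex \<Rightarrow> real" where
  "d_disk \<alpha> \<beta> =
     (if cmod \<alpha> = 1 \<and> \<alpha> = \<beta> then 0 else cmod ((\<alpha> - \<beta>) / (1 - cnj \<beta> * \<alpha>)))"

text \<open>
  A \<open>d\<close>-tuple of operators on \<open>\<complex>\<^sup>2\<close> is a \<^typ>\<open>(complex^2^2)^'d\<close>, its \<open>k\<close>-th operator
  being \<open>T $ k\<close>.
\<close>

definition joint_eigen :: "(complex^2^2)^'d \<Rightarrow> complex^'d \<Rightarrow> complex^2 \<Rightarrow> bool" where
  "joint_eigen T z v \<longleftrightarrow> (\<forall>k. (T $ k) *v v = (z $ k) *s v)"

definition generic :: "(complex^2^2)^'d \<Rightarrow> bool" where
  "generic T \<longleftrightarrow> (\<forall>j k. T $ j ** T $ k = T $ k ** T $ j) \<and>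
     (\<exists>v\<^sub>1 v\<^sub>2 z\<^sub>1 z\<^sub>2. v\<^sub>1 \<noteq> v\<^sub>2 \<and> vec.independent {v\<^sub>1, v\<^sub>2} \<and> z\<^sub>1 \<noteq> z\<^sub>2 \<and>
        joint_eigen T z\<^sub>1 v\<^sub>1 \<and> joint_eigen T z\<^sub>2 v\<^sub>2)"

text \<open>
  The joint spectrum as the set of joint eigenvalues. For generic \<open>T\<close> this is \<open>{z\<^sub>1, z\<^sub>2}\<close>,
  and the joint eigenvectors are exactly the nonzero multiples of \<open>v\<^sub>1\<close> and of \<open>v\<^sub>2\<close>.
  The values \<open>f(T)\<close> and \<open>\<Delta>(T)\<close> below are therefore described by their action on joint
  eigenvectors, without a choice of \<open>v\<^sub>1\<close> and \<open>v\<^sub>2\<close>.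
\<close>

definition joint_spectrum :: "(complex^2^2)^'d \<Rightarrow> (complex^'d) set" where
  "joint_spectrum T = {z. \<exists>v. v \<noteq> 0 \<and> joint_eigen T z v}"

definition fun_at :: "(complex^'d \<Rightarrow> complex) \<Rightarrow> (complex^2^2)^'d \<Rightarrow> complex^2^2" where
  "fun_at f T = (THE A. \<forall>z v. joint_eigen T z v \<longrightarrow> A *v v = f z *s v)"

text \<open>\<open>\<complex>\<^sup>n \<otimes> \<complex>\<^sup>2\<close> is realised as \<^typ>\<open>complex^('n \<times> 2)\<close>.\<close>

definition tensor :: "complex^'n \<Rightarrow> complex^2 \<Rightarrow> complex^('n \<times> 2)" where
  "tensor e v = (\<chi> p. e $ fst p * v $ snd p)"

definition Delta_at ::
  "(complex^'d \<Rightarrow> complex^'r^'s) \<Rightarrow> (complex^2^2)^'d \<Rightarrow> complex^('r \<times> 2)^('s \<times> 2)" where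
  "Delta_at \<Delta> T =
     (THE X. \<forall>z v e. joint_eigen T z v \<longrightarrow> X *v tensor e v = tensor (\<Delta> z *v e) v)"

text \<open>Functions on \<open>B_Delta E \<Delta>\<close> are total functions whose values elsewhere are irrelevant.\<close>

definition S2_gen ::
  "(complex^'d) set \<Rightarrow> (complex^'d \<Rightarrow> complex^'r^'s) \<Rightarrow> (complex^'d \<Rightarrow> complex) set" where
  "S2_gen E \<Delta> = {f. \<forall>T. generic T \<and> joint_spectrum T \<subseteq> B_Delta E \<Delta> \<and>
       opnorm (Delta_at \<Delta> T) \<le> 1 \<longrightarrow> opnorm (fun_at f T) \<le> 1}"

end

theory Submission
  imports Defs
begin

text \<open>
  For \<open>z \<noteq> w\<close> let \<open>T\<close> be the generic tuple with joint eigenvectors \<open>v\<^sub>1 = (1, 0)\<close>,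
  \<open>v\<^sub>2 = (\<mu>, 1)\<close> for \<open>z\<close>, \<open>w\<close>, where \<open>t\<^sup>2 = 1 / (1 + \<mu>\<^sup>2)\<close>, so that \<open>1 - t\<^sup>2\<close> is the squared
  cosine of the angle between \<open>v\<^sub>1\<close> and \<open>v\<^sub>2\<close>. Writing vectors as \<open>u \<otimes> v\<^sub>1 + v \<otimes> v\<^sub>2\<close>, the
  condition \<open>\<parallel>\<Delta>(T)\<parallel> \<le> 1\<close> becomes the nonnegativity of a \<open>2 \<times> 2\<close> block form, which follows
  from \<open>d_Delta \<Delta> z w \<le> t\<close>; the condition \<open>\<parallel>f(T)\<parallel> \<le> 1\<close> becomes the
  nonnegativity of a scalar \<open>2 \<times> 2\<close> form, whose determinant gives \<open>d_disk (f z) (f w) \<le> t\<close>.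
  Letting \<open>t\<close> decrease to \<open>d_Delta \<Delta> z w\<close> proves the claim; if \<open>d_Delta \<Delta> z w \<ge> 1\<close>, orthogonal
  eigenvectors (\<open>t = 1\<close>) suffice, since then \<open>\<parallel>\<Delta>(T)\<parallel> \<le> 1\<close> holds trivially.

  Only real parts of Hermitian inner products occur, so the library's real inner product on
  \<open>complex^'n\<close> is used throughout.
\<close>

section \<open>Adjoints and square roots of complex matrices\<close>

lemma inner_adjoint:
  fixes A :: "complex^'n^'m"
  shows "(A *v x) \<bullet> y = x \<bullet> (conj_transpose A *v y)"
proof -
  have "(A *v x) \<bullet> y = (\<Sum>i\<in>UNIV. \<Sum>j\<in>UNIV. (A$i$j * x$j) \<bullet> y$i)"
    by (simp add: inner_vec_def matrix_vector_mult_def inner_sum_left)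
  also have "\<dots> = (\<Sum>j\<in>UNIV. \<Sum>i\<in>UNIV. x$j \<bullet> (cnj (A$i$j) * y$i))"
    by (subst sum.swap) (simp add: inner_complex_def algebra_simps)
  also have "\<dots> = x \<bullet> (conj_transpose A *v y)"
    by (simp add: inner_vec_def matrix_vector_mult_def inner_sum_right conj_transpose_def)
  finally show ?thesis .
qed

lemma conj_transpose_conj_transpose [simp]: "conj_transpose (conj_transpose A) = A"
  by (simp add: conj_transpose_def vec_eq_iff)

lemma conj_transpose_diff: "conj_transpose (A - B) = conj_transpose A - conj_transpose B"
  by (simp add: conj_transpose_def vec_eq_iff)

lemma conj_transpose_add: "conj_transpose (A + B) = conj_transpose A + conj_transpose B"
  by (simp add: conj_transpose_def vec_eq_iff)

lemma conj_transpose_scaleR: "conj_transpose (r *\<^sub>R A) = r *\<^sub>R conj_transpose A"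
  by (simp add: conj_transpose_def vec_eq_iff)

lemma conj_transpose_mat_1 [simp]: "conj_transpose (mat 1) = mat 1"
  by (simp add: conj_transpose_def vec_eq_iff mat_def)

lemma conj_transpose_mult: "conj_transpose (A ** B) = conj_transpose B ** conj_transpose A"
  by (simp add: conj_transpose_def vec_eq_iff matrix_matrix_mult_def mult.commute)

lemma positive_semidef_iff:
  "positive_semidef A \<longleftrightarrow> conj_transpose A = A \<and> (\<forall>x. 0 \<le> (A *v x) \<bullet> x)"
  by (simp add: positive_semidef_def inner_vec_def inner_complex_def)

lemma opnorm_nonneg: "0 \<le> opnorm A"
  unfolding opnorm_def by (rule onorm_pos_le) simp

lemma norm_matrix_vector_le: "norm (A *v x) \<le> opnorm A * norm x"
  for A :: "complex^'n^'m"
  unfolding opnorm_def by (rule onorm) simp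

text \<open>Pairing \<open>conj_transpose A *v x\<close> with itself and moving one factor across
  gives \<open>(A *v ?y) \<bullet> x\<close>, to which Cauchy-Schwarz applies.\<close>

lemma norm_conj_transpose_vector_le: "norm (conj_transpose A *v x) \<le> opnorm A * norm x"
  for A :: "complex^'n^'m"
proof -
  let ?y = "conj_transpose A *v x"
  have "norm ?y * norm ?y = (A *v ?y) \<bullet> x"
    by (simp add: inner_adjoint flip: power2_eq_square power2_norm_eq_inner)
  also have "\<dots> \<le> norm (A *v ?y) * norm x"
    by (rule norm_cauchy_schwarz)
  also have "\<dots> \<le> (opnorm A * norm ?y) * norm x"
    by (intro mult_right_mono norm_matrix_vector_le) simp
  finally have "norm ?y * norm ?y \<le> norm ?y * (opnorm A * norm x)"
    by (simp add: ac_simps)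
  then show ?thesis
    by (cases "?y = 0") (simp_all add: opnorm_nonneg)
qed

lemma scaleR_matrix_vector: "(r *\<^sub>R A) *v x = r *\<^sub>R (A *v x)" for A :: "complex^'n^'m"
  by (simp add: matrix_vector_mult_def vec_eq_iff scaleR_sum_right)

lemma matrix_diff_ldistrib: "A ** (B - C) = A ** B - A ** (C :: 'a::ring_1^'n^'m)"
  by (simp add: matrix_matrix_mult_def vec_eq_iff right_diff_distrib sum_subtractf)

lemma matrix_diff_rdistrib: "(A - B) ** C = A ** C - B ** (C :: 'a::ring_1^'n^'m)"
  by (simp add: matrix_matrix_mult_def vec_eq_iff left_diff_distrib sum_subtractf)

lemma inner_conj_transpose:
  fixes M N :: "complex^'n^'m"
  shows "conj_transpose M \<bullet> conj_transpose N = M \<bullet> N"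
  by (simp add: inner_vec_def conj_transpose_def inner_complex_def) (rule sum.swap)

lemma inner_eq_sum_columns:
  fixes M N :: "complex^'n^'m"
  shows "M \<bullet> N = (\<Sum>j\<in>UNIV. column j M \<bullet> column j N)"
  by (simp add: inner_vec_def column_def) (rule sum.swap)

lemma column_mult: "column j (A ** B) = A *v column j B"
  by (simp add: column_def matrix_matrix_mult_def matrix_vector_mult_def vec_eq_iff)

text \<open>The Frobenius inner product is a sum over columns, so the bound on the quadratic form of
  \<open>A\<close> applies column by column.\<close>

lemma inner_mult_ge:
  fixes A :: "complex^'n^'n" and X :: "complex^'k^'n"
  assumes "\<And>x. r * (x \<bullet> x) \<le> (A *v x) \<bullet> x"
  shows "r * (X \<bullet> X) \<le> (A ** X) \<bullet> X"
  by (simp add: inner_eq_sum_columns column_mult sum_distrib_left sum_mono assms)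

text \<open>
  A fixed point \<open>Y\<close> of \<open>Y \<mapsto> (H + Y\<^sup>2) / 2\<close> satisfies \<open>(I - Y)\<^sup>2 = I - H\<close>, and this map
  preserves the compact convex set of Hermitian matrices of operator norm at most \<open>h\<close>.
\<close>

lemma sqrt_of_strict_contraction_complement:
  fixes H :: "complex^'n^'n"
  assumes H: "conj_transpose H = H" "\<And>x. norm (H *v x) \<le> h * norm x" and h: "0 \<le> h" "h < 1"
  obtains S where "conj_transpose S = S" "S ** S = mat 1 - H"
    "\<And>x. (1 - h) * (x \<bullet> x) \<le> (S *v x) \<bullet> x"
proof -
  define K :: "(complex^'n^'n) set"
    where "K = {Y. conj_transpose Y = Y \<and> (\<forall>x. norm (Y *v x) \<le> h * norm x)}"
  define F where "F Y = (1/2) *\<^sub>R (H + Y ** Y)" for Y :: "complex^'n^'n"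
  have "bounded K"
  proof -
    have "norm Y \<le> real CARD('n) * (real CARD('n) * h)" if "Y \<in> K" for Y
    proof -
      have entry: "norm (Y$i$j) \<le> h" for i j
      proof -
        have "Y$i$j = (Y *v axis j 1) $ i"
          by (simp add: matrix_vector_mult_def axis_def if_distrib cong: if_cong)
        also have "norm \<dots> \<le> norm (Y *v axis j 1)"
          by (rule Finite_Cartesian_Product.norm_nth_le)
        also have "\<dots> \<le> h * norm (axis j (1::complex) :: complex^'n)"
          using that unfolding K_def by blast
        finally show ?thesis
          by (simp add: norm_Basis axis_in_Basis_iff Basis_complex_def)
      qed
      have row: "norm (Y$i) \<le> real CARD('n) * h" for i
      proof -
        have "norm (Y$i) \<le> (\<Sum>j\<in>UNIV. norm (Y$i$j))"
          unfolding norm_vec_def by (rule L2_set_le_sum) simp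
        also have "\<dots> \<le> (\<Sum>j\<in>(UNIV::'n set). h)"
          by (intro sum_mono entry)
        finally show ?thesis by simp
      qed
      have "norm Y \<le> (\<Sum>i\<in>UNIV. norm (Y$i))"
        unfolding norm_vec_def[of Y] by (rule L2_set_le_sum) simp
      also have "\<dots> \<le> (\<Sum>i\<in>(UNIV::'n set). real CARD('n) * h)"
        by (intro sum_mono row)
      finally show ?thesis by simp
    qed
    then show ?thesis
      by (auto simp: bounded_iff)
  qed
  moreover have "closed K"
  proof -
    have 1: "continuous_on UNIV (\<lambda>Y::complex^'n^'n. conj_transpose Y)"
      unfolding conj_transpose_def by (intro continuous_intros)
    have 2: "continuous_on UNIV (\<lambda>Y::complex^'n^'n. Y *v x)" for x
      unfolding matrix_vector_mult_def by (intro continuous_intros)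
    show ?thesis
      unfolding K_def
      by (intro closed_Collect_conj closed_Collect_all closed_Collect_eq closed_Collect_le
          continuous_intros 1 2)
  qed
  ultimately have "compact K"
    by (simp add: compact_eq_bounded_closed)
  moreover have "convex K"
  proof (rule convexI)
    fix Y Z :: "complex^'n^'n" and u v :: real
    assume *: "Y \<in> K" "Z \<in> K" "0 \<le> u" "0 \<le> v" "u + v = 1"
    have "norm ((u *\<^sub>R Y + v *\<^sub>R Z) *v x) \<le> h * norm x" for x
    proof -
      have "norm ((u *\<^sub>R Y + v *\<^sub>R Z) *v x) \<le> norm (u *\<^sub>R (Y *v x)) + norm (v *\<^sub>R (Z *v x))"
        unfolding matrix_vector_mult_add_rdistrib scaleR_matrix_vector
        by (rule norm_triangle_ineq)
      also have "\<dots> \<le> u * (h * norm x) + v * (h * norm x)"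
        using * by (auto simp: K_def intro!: add_mono mult_left_mono)
      also have "\<dots> = h * norm x"
        using * by (metis distrib_right mult_1)
      finally show ?thesis .
    qed
    then show "u *\<^sub>R Y + v *\<^sub>R Z \<in> K"
      using * by (simp add: K_def conj_transpose_add conj_transpose_scaleR)
  qed
  moreover have "K \<noteq> {}"
    using H by (auto simp: K_def)
  moreover have "continuous_on K F"
    unfolding F_def matrix_matrix_mult_def by (intro continuous_intros)
  moreover have "F \<in> K \<rightarrow> K"
  proof
    fix Y assume Y: "Y \<in> K"
    have "norm (F Y *v x) \<le> h * norm x" for x
    proof -
      have "norm (Y *v (Y *v x)) \<le> h * (h * norm x)"
        using Y by (auto simp: K_def intro: order_trans mult_left_mono[OF _ h(1)])
      \<comment> \<open>Since \<open>h < 1\<close>, squaring keeps the bound \<open>h\<close>, and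
        so does averaging with \<open>H\<close>.\<close>
      also have "\<dots> \<le> 1 * (h * norm x)"
        using h by (intro mult_right_mono) auto
      finally have "norm (Y *v (Y *v x)) \<le> h * norm x" by simp
      then have "norm (H *v x + Y *v (Y *v x)) \<le> 2 * (h * norm x)"
        using H(2)[of x] norm_triangle_ineq[of "H *v x" "Y *v (Y *v x)"] by linarith
      then show ?thesis
        by (simp add: F_def matrix_vector_mult_add_rdistrib scaleR_matrix_vector
            flip: matrix_vector_mul_assoc)
    qed
    then show "F Y \<in> K"
      using Y H
      by (simp add: K_def F_def conj_transpose_add conj_transpose_scaleR conj_transpose_mult)
  qed
  ultimately obtain Y where Y: "Y \<in> K" "F Y = Y"
    by (rule brouwer)
  from Y(2) have "2 *\<^sub>R Y = 2 *\<^sub>R F Y" by simp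
  then have Y2: "Y + Y = H + Y ** Y"
    by (simp add: F_def flip: scaleR_2)
  show thesis
  proof
    show "conj_transpose (mat 1 - Y) = mat 1 - Y"
      using Y(1) by (simp add: K_def conj_transpose_diff)
    have "(mat 1 - Y) ** (mat 1 - Y) = mat 1 - (Y + Y) + Y ** Y"
      by (simp add: matrix_diff_ldistrib matrix_diff_rdistrib)
    also have "\<dots> = mat 1 - H"
      unfolding Y2 by simp
    finally show "(mat 1 - Y) ** (mat 1 - Y) = mat 1 - H" .
    show "(1 - h) * (x \<bullet> x) \<le> ((mat 1 - Y) *v x) \<bullet> x" for x
    proof -
      have "(Y *v x) \<bullet> x \<le> norm (Y *v x) * norm x"
        by (rule norm_cauchy_schwarz)
      also have "\<dots> \<le> (h * norm x) * norm x"
        using Y(1) by (intro mult_right_mono) (auto simp: K_def)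
      finally show ?thesis
        by (simp add: matrix_vector_mult_diff_rdistrib inner_diff_left algebra_simps
            power2_norm_eq_inner flip: power2_eq_square)
    qed
  qed
qed

text \<open>
  For two square roots \<open>P\<close>, \<open>S\<close> the difference \<open>X = P - S\<close> solves \<open>P X + X S = 0\<close>;
  pairing this with \<open>X\<close> in the Frobenius inner product forces \<open>X = 0\<close>.
\<close>

lemma mat_sqrt_eqI:
  fixes S :: "complex^'n^'n"
  assumes S: "conj_transpose S = S" "S ** S = A" and r: "0 < r"
    and S_ge: "\<And>x. r * (x \<bullet> x) \<le> (S *v x) \<bullet> x"
  shows "mat_sqrt A = S"
  unfolding mat_sqrt_def
proof (rule the_equality)
  have "0 \<le> (S *v x) \<bullet> x" for x
    using S_ge[of x] r by (meson inner_ge_zero less_imp_le mult_nonneg_nonneg order_trans)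
  then show "positive_semidef S \<and> S ** S = A"
    using S by (simp add: positive_semidef_iff)
next
  fix P assume P: "positive_semidef P \<and> P ** P = A"
  define X where "X = P - S"
  have X: "conj_transpose X = X"
    using P S by (simp add: X_def conj_transpose_diff positive_semidef_iff)
  have "P ** X + X ** S = 0"
    using P S by (simp add: X_def matrix_diff_ldistrib matrix_diff_rdistrib)
  then have "(P ** X) \<bullet> X + (X ** S) \<bullet> X = 0"
    by (simp flip: inner_add_left)
  \<comment> \<open>Taking adjoints preserves the Frobenius inner product and swaps the Hermitian
    factors \<open>X\<close> and \<open>S\<close>.\<close>
  moreover have "(X ** S) \<bullet> X = (S ** X) \<bullet> X"
    using X S inner_conj_transpose[of "X ** S" X] by (simp add: conj_transpose_mult)
  moreover have "0 * (X \<bullet> X) \<le> (P ** X) \<bullet> X"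
    using P by (intro inner_mult_ge) (simp add: positive_semidef_iff)
  moreover have "r * (X \<bullet> X) \<le> (S ** X) \<bullet> X"
    by (intro inner_mult_ge S_ge)
  ultimately have "r * (X \<bullet> X) \<le> 0"
    by simp
  then have "X = 0"
    using r by (metis inner_gt_zero_iff mult_pos_pos not_le)
  then show "P = S"
    by (simp add: X_def)
qed

lemma invertibleI_ker:
  fixes A :: "complex^'n^'n"
  assumes "\<And>x. A *v x = 0 \<Longrightarrow> x = 0"
  shows "invertible A"
  using assms matrix_left_invertible_ker[of A] invertible_left_inverse by blast

lemma matrix_inv_vector:
  fixes A :: "complex^'n^'n"
  assumes "invertible A"
  shows "matrix_inv A *v (A *v x) = x" "A *v (matrix_inv A *v x) = x"
proof -
  have "A ** matrix_inv A = mat 1 \<and> matrix_inv A ** A = mat 1"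
    using assms unfolding invertible_def matrix_inv_def by (rule someI_ex)
  then show "matrix_inv A *v (A *v x) = x" "A *v (matrix_inv A *v x) = x"
    by (simp_all add: matrix_vector_mul_assoc)
qed

text \<open>Serves for both defect operators of a contraction, since \<open>B\<close> may be
  replaced by its adjoint. Invertibility comes from the lower bound \<open>1 - \<beta>\<close> on
  the form of the root.\<close>

lemma mat_sqrt_strict_contraction:
  fixes B :: "complex^'m^'n"
  assumes B: "\<And>x. norm (B *v x) \<le> \<beta> * norm x"
    "\<And>x. norm (conj_transpose B *v x) \<le> \<beta> * norm x" and \<beta>: "0 \<le> \<beta>" "\<beta> < 1"
  defines "S \<equiv> mat_sqrt (mat 1 - B ** conj_transpose B)"
  shows "conj_transpose S = S" "S *v (S *v x) = x - B *v (conj_transpose B *v x)" "invertible S"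
proof -
  have "norm ((B ** conj_transpose B) *v x) \<le> \<beta> * norm x" for x
  proof -
    have "norm ((B ** conj_transpose B) *v x) \<le> \<beta> * norm (conj_transpose B *v x)"
      using B(1) by (simp flip: matrix_vector_mul_assoc)
    also have "\<dots> \<le> 1 * norm (conj_transpose B *v x)"
      using \<beta> by (intro mult_right_mono) auto
    finally show ?thesis
      using B(2)[of x] by simp
  qed
  moreover have "conj_transpose (B ** conj_transpose B) = B ** conj_transpose B"
    by (simp add: conj_transpose_mult)
  ultimately obtain R where R: "conj_transpose R = R" "R ** R = mat 1 - B ** conj_transpose B"
    "\<And>x. (1 - \<beta>) * (x \<bullet> x) \<le> (R *v x) \<bullet> x"
    using sqrt_of_strict_contraction_complement \<beta> by blast
  have "S = R"
    unfolding S_def by (rule mat_sqrt_eqI[OF R(1,2) _ R(3)]) (use \<beta> in simp)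
  then show "conj_transpose S = S" "S *v (S *v x) = x - B *v (conj_transpose B *v x)"
    using R(1,2)
    by (simp_all add: matrix_vector_mul_assoc matrix_vector_mult_diff_rdistrib)
  show "invertible S"
  proof (rule invertibleI_ker)
    fix x assume "S *v x = 0"
    then have "(1 - \<beta>) * (x \<bullet> x) \<le> 0"
      using R(3)[of x] \<open>S = R\<close> by simp
    then show "x = 0"
      using \<beta>(2) by (metis diff_gt_0_iff_gt inner_gt_zero_iff mult_pos_pos not_le)
  qed
qed

section \<open>The contraction inequalities\<close>

text \<open>A kernel vector \<open>x\<close> equals \<open>conj_transpose B *v (A *v x)\<close>,
  whose norm is at most \<open>opnorm A * norm x\<close>; this forces \<open>x = 0\<close>.\<close>

lemma invertible_one_minus_adjoint_mult:
  fixes A B :: "complex^'r^'s"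
  assumes "opnorm A < 1" "opnorm B < 1"
  shows "invertible (mat 1 - conj_transpose B ** A)"
proof (rule invertibleI_ker)
  fix x assume "(mat 1 - conj_transpose B ** A) *v x = 0"
  then have "x = conj_transpose B *v (A *v x)"
    by (simp add: matrix_vector_mult_diff_rdistrib matrix_vector_mul_assoc)
  then have "norm x \<le> opnorm B * norm (A *v x)"
    using norm_conj_transpose_vector_le[of B "A *v x"] by simp
  also have "\<dots> \<le> 1 * norm (A *v x)"
    using assms(2) by (intro mult_right_mono) auto
  also have "\<dots> \<le> opnorm A * norm x"
    using norm_matrix_vector_le[of A x] by simp
  finally have "(1 - opnorm A) * norm x \<le> 0"
    by (simp add: algebra_simps)
  then show "x = 0"
    using assms(1) by (simp add: mult_le_0_iff)
qed

text \<open>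
  With \<open>p = P\<^sup>-\<^sup>2 (u - B\<^sup>* a)\<close> one has \<open>Q\<^sup>-\<^sup>2 (a - B u) = a - B p\<close>, which replaces both inverses
  by the single vector \<open>p\<close>.
\<close>

lemma julia_identity:
  fixes B :: "complex^'r^'s" and u :: "complex^'r" and a :: "complex^'s"
  assumes B: "opnorm B < 1"
  defines "P \<equiv> mat_sqrt (mat 1 - conj_transpose B ** B)"
    and "Q \<equiv> mat_sqrt (mat 1 - B ** conj_transpose B)"
  shows "(norm (matrix_inv Q *v (a - B *v u)))\<^sup>2 =
    (norm (matrix_inv P *v (u - conj_transpose B *v a)))\<^sup>2 - ((norm u)\<^sup>2 - (norm a)\<^sup>2)"
proof -
  let ?B = "conj_transpose B"
  note bounds = norm_matrix_vector_le[of B] norm_conj_transpose_vector_le[of B]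
  note Q = mat_sqrt_strict_contraction[OF bounds opnorm_nonneg B, folded Q_def]
  note P = mat_sqrt_strict_contraction[of ?B "opnorm B", simplified,
      OF bounds(2,1) opnorm_nonneg B, folded P_def]
  define y where "y = matrix_inv P *v (u - ?B *v a)"
  define p where "p = matrix_inv P *v y"
  define d where "d = matrix_inv Q *v (a - B *v u)"
  have y: "P *v y = u - ?B *v a" and p: "P *v p = y" and d: "Q *v d = a - B *v u"
    by (simp_all add: y_def p_def d_def matrix_inv_vector P(3) Q(3))
  \<comment> \<open>This is \<open>P *v (P *v p) = u - ?B *v a\<close> solved for \<open>u\<close>.
    Applying \<open>B\<close> yields \<open>Q *v (Q *v (a - B *v p)) = a - B *v u\<close>, and one
    factor \<open>Q\<close> cancels.\<close>
  have u: "u = p - ?B *v (B *v p) + ?B *v a"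
    using P(2)[of p] unfolding p y by (metis diff_add_cancel)
  have "B *v u = B *v (p - ?B *v (B *v p) + ?B *v a)"
    using u by simp
  then have "Q *v (Q *v (a - B *v p)) = Q *v d"
    unfolding Q(2) d by (simp add: algebra_simps)
  then have "Q *v (a - B *v p) = d"
    by (metis Q(3) matrix_inv_vector(1))
  then have "d \<bullet> d = (a - B *v u) \<bullet> (a - B *v p)"
    using inner_adjoint[of Q d "a - B *v p"] by (simp add: Q(1) d)
  moreover have "y \<bullet> y = (u - ?B *v a) \<bullet> p"
    using inner_adjoint[of P y p] by (simp add: P(1) y p)
  moreover have "u \<bullet> u = u \<bullet> p - (B *v u) \<bullet> (B *v p) + (B *v u) \<bullet> a"
    using arg_cong[OF u, of "inner u"] by (simp add: inner_adjoint inner_diff_right inner_add_right)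
  moreover have "(?B *v a) \<bullet> p = a \<bullet> (B *v p)"
    using inner_adjoint[of ?B a p] by simp
  ultimately have "d \<bullet> d = y \<bullet> y - (u \<bullet> u - a \<bullet> a)"
    by (simp add: inner_diff_left inner_diff_right inner_commute)
  then show ?thesis
    by (simp add: d_def y_def power2_norm_eq_inner)
qed

text \<open>
  In terms of \<open>y = P\<^sup>-\<^sup>1 (I - B\<^sup>* A) u\<close>, the difference of the two sides is
  \<open>\<parallel>u\<parallel>\<^sup>2 - \<parallel>A u\<parallel>\<^sup>2 + 2 \<mu> \<langle>y, P v\<rangle> + (1 + \<mu>\<^sup>2) \<parallel>P v\<parallel>\<^sup>2\<close>, and one completes the square.
\<close>

lemma d_Delta_contraction:
  fixes \<Delta> :: "complex^'d \<Rightarrow> complex^'r^'s" and \<mu> t :: real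
  assumes z: "opnorm (\<Delta> z) < 1" and w: "opnorm (\<Delta> w) < 1"
    and t: "(1 + \<mu>\<^sup>2) * t\<^sup>2 = 1" "0 \<le> t" "t = 1 \<or> d_Delta \<Delta> z w \<le> t"
  shows "(norm (\<Delta> z *v u))\<^sup>2 + 2 * \<mu> * ((\<Delta> z *v u) \<bullet> (\<Delta> w *v v))
      + (1 + \<mu>\<^sup>2) * (norm (\<Delta> w *v v))\<^sup>2
    \<le> (norm u)\<^sup>2 + 2 * \<mu> * (u \<bullet> v) + (1 + \<mu>\<^sup>2) * (norm v)\<^sup>2"
proof -
  define A where "A = \<Delta> z"
  define B where "B = \<Delta> w"
  have A: "opnorm A < 1" and B: "opnorm B < 1"
    using z w by (simp_all add: A_def B_def)
  let ?B = "conj_transpose B"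
  define P where "P = mat_sqrt (mat 1 - ?B ** B)"
  define Q where "Q = mat_sqrt (mat 1 - B ** ?B)"
  note bounds = norm_matrix_vector_le[of B] norm_conj_transpose_vector_le[of B]
  note P = mat_sqrt_strict_contraction[of ?B "opnorm B", simplified,
      OF bounds(2,1) opnorm_nonneg B, folded P_def]
  define C where "C = mat 1 - ?B ** A"
  have inv: "invertible C"
    unfolding C_def by (rule invertible_one_minus_adjoint_mult) fact+
  define y where "y = matrix_inv P *v (C *v u)"
  define D where "D = (norm u)\<^sup>2 - (norm (A *v u))\<^sup>2"
  define p where "p = P *v v"
  have Cu: "C *v u = u - ?B *v (A *v u)"
    by (simp add: C_def matrix_vector_mult_diff_rdistrib matrix_vector_mul_assoc)
  have Py: "P *v y = C *v u"
    by (simp add: y_def matrix_inv_vector P(3))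
  \<comment> \<open>For \<open>t = 1\<close> this says that \<open>A\<close> does not increase the
    norm of \<open>u\<close>. Otherwise the matrix \<open>?M\<close> defining \<open>d_Delta\<close>
    has norm at most \<open>t\<close>, and \<open>julia_identity\<close> computes the norm of
    \<open>?M *v y\<close>.\<close>
  have D: "(1 - t\<^sup>2) * (norm y)\<^sup>2 \<le> D"
    using t(3)
  proof
    assume "t = 1"
    have "norm (A *v u) \<le> opnorm A * norm u"
      by (rule norm_matrix_vector_le)
    also have "\<dots> \<le> 1 * norm u"
      using A by (intro mult_right_mono) auto
    finally show ?thesis
      using \<open>t = 1\<close> by (simp add: D_def power_mono)
  next
    assume le: "d_Delta \<Delta> z w \<le> t"
    let ?M = "matrix_inv Q ** (A - B) ** matrix_inv C ** P"
    have "?M *v y = matrix_inv Q *v ((A - B) *v (matrix_inv C *v (C *v u)))"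
      by (simp add: Py flip: matrix_vector_mul_assoc)
    also have "\<dots> = matrix_inv Q *v (A *v u - B *v u)"
      by (simp add: matrix_inv_vector inv matrix_vector_mult_diff_rdistrib)
    finally have "(norm (?M *v y))\<^sup>2 = (norm y)\<^sup>2 - D"
      using julia_identity[OF B, of "A *v u" u]
      by (simp add: y_def Cu D_def P_def Q_def)
    moreover have "opnorm ?M \<le> t"
      using le by (simp add: d_Delta_def A_def B_def P_def Q_def C_def)
    then have "norm (?M *v y) \<le> t * norm y"
      by (meson mult_right_mono norm_ge_zero norm_matrix_vector_le order_trans)
    then have "(norm (?M *v y))\<^sup>2 \<le> (t * norm y)\<^sup>2"
      by (simp add: power_mono)
    ultimately show ?thesis
      by (simp add: algebra_simps power_mult_distrib)
  qed
  have uv: "u \<bullet> v - (A *v u) \<bullet> (B *v v) = y \<bullet> p"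
  proof -
    have "(A *v u) \<bullet> (B *v v) = (?B *v (A *v u)) \<bullet> v"
      by (simp add: inner_adjoint)
    then have "u \<bullet> v - (A *v u) \<bullet> (B *v v) = (P *v y) \<bullet> v"
      by (simp add: Py Cu inner_diff_left)
    then show ?thesis
      by (simp add: inner_adjoint P(1) p_def)
  qed
  have vv: "(norm v)\<^sup>2 - (norm (B *v v))\<^sup>2 = (norm p)\<^sup>2"
  proof -
    have "p \<bullet> p = v \<bullet> (P *v (P *v v))"
      unfolding p_def by (simp add: inner_adjoint P(1))
    also have "\<dots> = v \<bullet> v - (B *v v) \<bullet> (B *v v)"
      unfolding P(2) by (simp add: inner_diff_right inner_adjoint)
    finally show ?thesis
      by (simp add: power2_norm_eq_inner)
  qed
  \<comment> \<open>With \<open>(1 + \<mu>\<^sup>2) * t\<^sup>2 = 1\<close> this square expands to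
    the wanted form, with \<open>(1 - t\<^sup>2) * (norm y)\<^sup>2\<close> in place of
    \<open>D\<close>.\<close>
  have "0 \<le> (norm (t *\<^sub>R \<mu> *\<^sub>R y + ((1 + \<mu>\<^sup>2) * t) *\<^sub>R p))\<^sup>2"
    by simp
  also have "\<dots> = (\<mu>\<^sup>2 * t\<^sup>2) * (norm y)\<^sup>2 + 2 * \<mu> * ((1 + \<mu>\<^sup>2) * t\<^sup>2) * (y \<bullet> p)
      + (1 + \<mu>\<^sup>2) * ((1 + \<mu>\<^sup>2) * t\<^sup>2) * (norm p)\<^sup>2"
    unfolding power2_norm_eq_inner
    by (simp add: inner_add_left inner_add_right inner_commute[of p y] power2_eq_square algebra_simps)
  also have "\<mu>\<^sup>2 * t\<^sup>2 = 1 - t\<^sup>2"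
    using t(1) by (simp add: algebra_simps)
  finally have "0 \<le> D + 2 * \<mu> * (y \<bullet> p) + (1 + \<mu>\<^sup>2) * (norm p)\<^sup>2"
    using D t(1) by simp
  then show ?thesis
    unfolding uv[symmetric] vv[symmetric] D_def A_def B_def by (simp add: algebra_simps)
qed

text \<open>
  The hypothesis says that the Hermitian form with matrix entries
  \<open>1 - \<bar>a\<bar>\<^sup>2\<close>, \<open>\<mu> (1 - a cnj b)\<close>, \<open>(1 + \<mu>\<^sup>2) (1 - \<bar>b\<bar>\<^sup>2)\<close> is nonnegative; the conclusion is that its
  determinant is nonnegative.
\<close>

lemma disk_contraction_det:
  fixes a b :: complex and \<mu> :: real
  assumes "\<And>\<alpha> \<beta>. (cmod (a * \<alpha>))\<^sup>2 + 2 * \<mu> * ((a * \<alpha>) \<bullet> (b * \<beta>)) + (1 + \<mu>\<^sup>2) * (cmod (b * \<beta>))\<^sup>2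
    \<le> (cmod \<alpha>)\<^sup>2 + 2 * \<mu> * (\<alpha> \<bullet> \<beta>) + (1 + \<mu>\<^sup>2) * (cmod \<beta>)\<^sup>2"
  shows "(1 + \<mu>\<^sup>2) * (cmod (a - b))\<^sup>2 \<le> (cmod (1 - cnj b * a))\<^sup>2"
proof -
  define g where "g = of_real \<mu> * (1 - a * cnj b)"
  define N where "N = 1 + \<mu>\<^sup>2"
  define D1 where "D1 = 1 - (cmod a)\<^sup>2"
  define D2 where "D2 = 1 - (cmod b)\<^sup>2"
  define G where "G = (cmod g)\<^sup>2"
  have "N > 0"
    by (simp add: N_def add_pos_nonneg)
  have form: "0 \<le> D1 * (cmod \<alpha>)\<^sup>2 + N * D2 * (cmod \<beta>)\<^sup>2 + 2 * Re (\<alpha> * cnj \<beta> * g)" for \<alpha> \<beta>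
  proof -
    have "Re (\<alpha> * cnj \<beta> * g) = \<mu> * (\<alpha> \<bullet> \<beta>) - \<mu> * ((a * \<alpha>) \<bullet> (b * \<beta>))"
      by (simp add: g_def inner_complex_def algebra_simps)
    then show ?thesis
      using assms[of \<alpha> \<beta>]
      by (simp add: D1_def D2_def N_def norm_mult power_mult_distrib algebra_simps)
  qed
  have gg: "g * cnj g = of_real G"
    by (simp only: G_def complex_norm_square)
  have D1: "0 \<le> D1"
    using form[of 1 0] by simp
  have D2: "0 \<le> D2"
    using form[of 0 1] \<open>N > 0\<close> by (simp add: zero_le_mult_iff)
  have "G \<le> N * D1 * D2"
  proof (cases "D2 = 0")
    case False
    \<comment> \<open>For first entry \<open>N * D2\<close> the form is minimal at second entry
      \<open>- g\<close>, where it equals \<open>N * D2\<close> times the determinant.\<close>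
    have "Re (of_real (N * D2) * cnj (- g) * g) = - (N * D2 * G)"
      using gg by (simp add: mult.commute[of "cnj g"] mult.assoc)
    then have "0 \<le> D1 * (N * D2)\<^sup>2 + N * D2 * G - 2 * (N * D2 * G)"
      using form[of "of_real (N * D2)" "- g"] by (simp add: norm_mult G_def power_mult_distrib)
    then have "0 \<le> (N * D2) * (N * D1 * D2 - G)"
      by (simp add: power2_eq_square algebra_simps)
    moreover have "0 < N * D2"
      using False D2 \<open>N > 0\<close> by simp
    ultimately show ?thesis
      by (simp only: zero_le_mult_iff) linarith
  next
    case D2_0: True
    \<comment> \<open>With \<open>D2 = 0\<close> the claim is \<open>G = 0\<close>; test pairs with
      a negative cross term give it.\<close>
    show ?thesis
    proof (cases "D1 = 0")
      case False
      have "Re (- cnj g * cnj (of_real D1) * g) = - (D1 * G)"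
        using gg by (simp add: mult.commute[of "cnj g"] mult.left_commute mult.assoc)
      then have "0 \<le> - (D1 * G)"
        using form[of "- cnj g" "of_real D1"] by (simp add: G_def D2_0)
      then show ?thesis
        using False D1 D2_0 by (simp add: mult_le_0_iff)
    next
      case True
      have "Re (1 * cnj (- g) * g) = - G"
        using gg by (simp add: mult.commute[of "cnj g"])
      then show ?thesis
        using form[of 1 "- g"] D2_0 True by simp
    qed
  qed
  moreover have "G = \<mu>\<^sup>2 * (cmod (1 - cnj b * a))\<^sup>2"
    by (simp add: G_def g_def norm_mult power_mult_distrib mult.commute)
  \<comment> \<open>This identity, basic to the pseudohyperbolic metric, brings
    \<open>cmod (a - b)\<close> into the determinant inequality.\<close>
  moreover have "D1 * D2 = (cmod (1 - cnj b * a))\<^sup>2 - (cmod (a - b))\<^sup>2"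
    unfolding D1_def D2_def cmod_power2 by (simp add: power2_eq_square algebra_simps)
  ultimately have "\<mu>\<^sup>2 * (cmod (1 - cnj b * a))\<^sup>2
      \<le> (1 + \<mu>\<^sup>2) * ((cmod (1 - cnj b * a))\<^sup>2 - (cmod (a - b))\<^sup>2)"
    by (simp only: N_def mult.assoc)
  then show ?thesis
    by (simp add: algebra_simps)
qed

section \<open>Generic tuples with two prescribed joint eigenvalues\<close>

text \<open>The matrix with eigenvectors \<open>(1, 0)\<close> and \<open>(\<mu>, 1)\<close> for the eigenvalues \<open>a\<close> and \<open>b\<close>.\<close>

definition eigen_mat :: "real \<Rightarrow> complex \<Rightarrow> complex \<Rightarrow> complex^2^2" where
  "eigen_mat \<mu> a b = vector [vector [a, (b - a) * of_real \<mu>], vector [0, b]]"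

lemma eigen_mat_vector:
  "(eigen_mat \<mu> a b *v x) $ 1 = a * (x $ 1 - of_real \<mu> * x $ 2) + of_real \<mu> * (b * x $ 2)"
  "(eigen_mat \<mu> a b *v x) $ 2 = b * x $ 2"
  by (simp_all add: eigen_mat_def matrix_vector_mult_def sum_2 algebra_simps)

lemma eigen_mat_commute: "eigen_mat \<mu> a b ** eigen_mat \<mu> a' b' = eigen_mat \<mu> a' b' ** eigen_mat \<mu> a b"
  by (simp add: eigen_mat_def matrix_matrix_mult_def vec_eq_iff forall_2 sum_2 algebra_simps)

definition eigen_tuple :: "real \<Rightarrow> complex^'d \<Rightarrow> complex^'d \<Rightarrow> (complex^2^2)^'d" where
  "eigen_tuple \<mu> z w = (\<chi> k. eigen_mat \<mu> (z $ k) (w $ k))"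

text \<open>If \<open>v $ 2\<close> is nonzero, the second coordinate forces
  \<open>\<zeta> = w\<close>, and an index where \<open>z\<close> and \<open>w\<close> differ puts
  \<open>v\<close> on the line of \<open>(\<mu>, 1)\<close>. If it is zero, the first coordinate
  decides.\<close>

lemma joint_eigen_eigen_tuple_iff:
  fixes z w :: "complex^'d"
  assumes "z \<noteq> w"
  shows "joint_eigen (eigen_tuple \<mu> z w) \<zeta> v \<longleftrightarrow>
    v = 0 \<or> \<zeta> = z \<and> v $ 2 = 0 \<or> \<zeta> = w \<and> v $ 1 = of_real \<mu> * v $ 2"
    (is "?L \<longleftrightarrow> ?R")
proof
  assume ?R
  then show ?L
    by (auto simp: joint_eigen_def eigen_tuple_def vec_eq_iff forall_2 eigen_mat_vector)
next
  assume ?L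
  then have 1: "z $ k * (v $ 1 - of_real \<mu> * v $ 2) + of_real \<mu> * (w $ k * v $ 2) = \<zeta> $ k * v $ 1"
    and 2: "w $ k * v $ 2 = \<zeta> $ k * v $ 2" for k
    by (simp_all add: joint_eigen_def eigen_tuple_def vec_eq_iff[of "_ *v _"] forall_2 eigen_mat_vector)
  show ?R
  proof (cases "v $ 2 = 0")
    case True
    then show ?thesis
      using 1 by (auto simp: vec_eq_iff forall_2)
  next
    case False
    then have \<zeta>: "\<zeta> = w"
      using 2 by (simp add: vec_eq_iff)
    obtain k where k: "z $ k \<noteq> w $ k"
      using assms by (auto simp: vec_eq_iff)
    have "(z $ k - w $ k) * (v $ 1 - of_real \<mu> * v $ 2) = 0"
      using 1[of k] by (simp add: \<zeta> algebra_simps)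
    then show ?thesis
      using k \<zeta> by simp
  qed
qed

lemma joint_spectrum_eigen_tuple:
  fixes z w :: "complex^'d"
  assumes "z \<noteq> w"
  shows "joint_spectrum (eigen_tuple \<mu> z w) \<subseteq> {z, w}"
  by (auto simp: joint_spectrum_def joint_eigen_eigen_tuple_iff[OF assms])

lemma generic_eigen_tuple:
  fixes z w :: "complex^'d"
  assumes "z \<noteq> w"
  shows "generic (eigen_tuple \<mu> z w)"
proof -
  let ?v = "vector [1, 0] :: complex^2" and ?w = "vector [of_real \<mu>, 1] :: complex^2"
  have "?v \<noteq> ?w"
    by (simp add: vec_eq_iff forall_2)
  moreover have "vec.independent {?v, ?w}"
  proof (rule vec.independent_insertI)
    show "?v \<notin> vec.span {?w}"
      by (auto simp: vec.span_singleton vec_eq_iff forall_2)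
    show "vec.independent {?w}"
      by (simp add: vec_eq_iff forall_2)
  qed
  moreover have "joint_eigen (eigen_tuple \<mu> z w) z ?v" "joint_eigen (eigen_tuple \<mu> z w) w ?w"
    by (simp_all add: joint_eigen_eigen_tuple_iff[OF assms])
  moreover have "eigen_tuple \<mu> z w $ j ** eigen_tuple \<mu> z w $ k =
      eigen_tuple \<mu> z w $ k ** eigen_tuple \<mu> z w $ j" for j k
    by (simp add: eigen_tuple_def eigen_mat_commute)
  ultimately show ?thesis
    unfolding generic_def using assms by blast
qed

lemma fun_at_eigen_tuple:
  fixes z w :: "complex^'d"
  assumes "z \<noteq> w"
  shows "fun_at f (eigen_tuple \<mu> z w) = eigen_mat \<mu> (f z) (f w)"
  unfolding fun_at_def
proof (rule the_equality)
  show "\<forall>\<zeta> v. joint_eigen (eigen_tuple \<mu> z w) \<zeta> v \<longrightarrow> eigen_mat \<mu> (f z) (f w) *v v = f \<zeta> *s v"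
    unfolding joint_eigen_eigen_tuple_iff[OF assms]
    by (intro allI impI, elim disjE conjE; simp add: vec_eq_iff[of _ "_ *s _"] forall_2 eigen_mat_vector)
next
  fix A assume A: "\<forall>\<zeta> v. joint_eigen (eigen_tuple \<mu> z w) \<zeta> v \<longrightarrow> A *v v = f \<zeta> *s v"
  have "A *v vector [1, 0] = f z *s vector [1, 0]"
    "A *v vector [of_real \<mu>, 1] = f w *s vector [of_real \<mu>, 1]"
    using A by (auto simp: joint_eigen_eigen_tuple_iff[OF assms])
  then show "A = eigen_mat \<mu> (f z) (f w)"
    by (simp add: eigen_mat_def vec_eq_iff forall_2 matrix_vector_mult_def sum_2 algebra_simps)
qed

section \<open>The block matrix of \<open>Delta_at\<close>\<close>

definition slice :: "2 \<Rightarrow> complex^('n \<times> 2) \<Rightarrow> complex^'n" where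
  "slice a x = (\<chi> i. x $ (i, a))"

lemma slice_nth [simp]: "slice a x $ i = x $ (i, a)"
  by (simp add: slice_def)

lemma of_real_mult_smult: "(of_real \<mu> * c) *s e = \<mu> *\<^sub>R (c *s e)" for c :: complex
  by (simp add: vec_eq_iff scaleR_conv_of_real[where 'a=complex])

lemma vec_eq_slice_iff: "x = y \<longleftrightarrow> slice 1 x = slice 1 y \<and> slice 2 x = slice 2 y"
  by (auto simp: vec_eq_iff forall_2)

lemma norm_slices: "(norm x)\<^sup>2 = (norm (slice 1 x))\<^sup>2 + (norm (slice 2 x))\<^sup>2"
  for x :: "complex^('n::finite \<times> 2)"
proof -
  have "x \<bullet> x = (\<Sum>i\<in>UNIV. \<Sum>a\<in>UNIV. x $ (i, a) \<bullet> x $ (i, a))"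
    by (simp add: inner_vec_def sum.cartesian_product case_prod_unfold)
  then show ?thesis
    by (simp add: power2_norm_eq_inner inner_vec_def sum_2 sum.distrib)
qed

lemma slice_tensor [simp]: "slice a (tensor e v) = v $ a *s e"
  by (simp add: tensor_def vec_eq_iff mult.commute)

definition eigen_block :: "real \<Rightarrow> complex^'r^'s \<Rightarrow> complex^'r^'s \<Rightarrow> complex^('r \<times> 2)^('s \<times> 2)" where
  "eigen_block \<mu> A B = (\<chi> p q. eigen_mat \<mu> (A $ fst p $ fst q) (B $ fst p $ fst q) $ snd p $ snd q)"

text \<open>In terms of the two eigenvectors, \<open>x\<close> has the coefficients
  \<open>slice 1 x - \<mu> *\<^sub>R slice 2 x\<close> and \<open>slice 2 x\<close>;
  \<open>A\<close> acts on the former and \<open>B\<close> on the latter.\<close>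

lemma slice_eigen_block:
  fixes A B :: "complex^'r^'s"
  shows "slice 1 (eigen_block \<mu> A B *v x) =
      A *v (slice 1 x - \<mu> *\<^sub>R slice 2 x) + \<mu> *\<^sub>R (B *v slice 2 x)"
    and "slice 2 (eigen_block \<mu> A B *v x) = B *v slice 2 x"
proof -
  have *: "(eigen_block \<mu> A B *v x) $ (i, a) = (\<Sum>j\<in>UNIV. \<Sum>b\<in>UNIV.
      eigen_mat \<mu> (A $ i $ j) (B $ i $ j) $ a $ b * x $ (j, b))" for i a
    by (simp add: matrix_vector_mult_def eigen_block_def sum.cartesian_product case_prod_unfold)
  have "slice 1 (eigen_block \<mu> A B *v x) $ i =
      (A *v (slice 1 x - \<mu> *\<^sub>R slice 2 x) + \<mu> *\<^sub>R (B *v slice 2 x)) $ i" for i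
    unfolding slice_nth *
    by (simp add: sum_2 eigen_mat_def matrix_vector_mult_def scaleR_conv_of_real[where 'a=complex]
        sum_distrib_left algebra_simps flip: sum.distrib)
  then show "slice 1 (eigen_block \<mu> A B *v x) =
      A *v (slice 1 x - \<mu> *\<^sub>R slice 2 x) + \<mu> *\<^sub>R (B *v slice 2 x)"
    by (simp only: vec_eq_iff simp_thms)
  have "slice 2 (eigen_block \<mu> A B *v x) $ i = (B *v slice 2 x) $ i" for i
    unfolding slice_nth *
    by (simp add: sum_2 eigen_mat_def matrix_vector_mult_def)
  then show "slice 2 (eigen_block \<mu> A B *v x) = B *v slice 2 x"
    by (simp only: vec_eq_iff simp_thms)
qed

lemma Delta_at_eigen_tuple:
  fixes z w :: "complex^'d" and \<Delta> :: "complex^'d \<Rightarrow> complex^'r^'s"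
  assumes "z \<noteq> w"
  shows "Delta_at \<Delta> (eigen_tuple \<mu> z w) = eigen_block \<mu> (\<Delta> z) (\<Delta> w)"
proof -
  let ?T = "eigen_tuple \<mu> z w" and ?X = "eigen_block \<mu> (\<Delta> z) (\<Delta> w)"
  have X: "?X *v tensor e v = tensor (\<Delta> \<zeta> *v e) v" if "joint_eigen ?T \<zeta> v" for \<zeta> v e
    using that
    unfolding joint_eigen_eigen_tuple_iff[OF assms] vec_eq_slice_iff[of "_ *v _"]
      slice_eigen_block slice_tensor
    by (elim disjE conjE; simp add: vector_scalar_commute of_real_mult_smult)
  show ?thesis
    unfolding Delta_at_def
  proof (rule the_equality)
    show "\<forall>\<zeta> v e. joint_eigen ?T \<zeta> v \<longrightarrow> ?X *v tensor e v = tensor (\<Delta> \<zeta> *v e) v"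
      using X by blast
  next
    fix Y :: "complex^('r \<times> 2)^('s \<times> 2)"
    assume Y: "\<forall>\<zeta> v e. joint_eigen ?T \<zeta> v \<longrightarrow> Y *v tensor e v = tensor (\<Delta> \<zeta> *v e) v"
    have "Y *v x = ?X *v x" for x
    proof -
      let ?v = "vector [1, 0] :: complex^2" and ?w = "vector [of_real \<mu>, 1] :: complex^2"
      have "joint_eigen ?T z ?v" "joint_eigen ?T w ?w"
        by (simp_all add: joint_eigen_eigen_tuple_iff[OF assms])
      then have "Y *v tensor e ?v = ?X *v tensor e ?v" "Y *v tensor e ?w = ?X *v tensor e ?w" for e
        using X Y by simp_all
      then have "Y *v (tensor e ?v + tensor e' ?w) = ?X *v (tensor e ?v + tensor e' ?w)" for e e'
        by (simp only: matrix_vector_right_distrib)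
      \<comment> \<open>Tensors with the two eigenvectors span the space, so the action on them
        determines \<open>Y\<close>.\<close>
      moreover have "tensor (slice 1 x - \<mu> *\<^sub>R slice 2 x) ?v + tensor (slice 2 x) ?w = x"
        by (simp add: tensor_def vec_eq_iff forall_2 scaleR_conv_of_real[where 'a=complex])
      ultimately show ?thesis
        by metis
    qed
    then show "Y = ?X"
      by (simp add: matrix_eq)
  qed
qed

text \<open>Both sides are the squared norm of \<open>x \<otimes> v1 + y \<otimes> v2\<close> with
  \<open>v1 = (1, 0)\<close>, \<open>v2 = (\<mu>, 1)\<close>: by coordinates on the left, by the
  Gram matrix on the right.\<close>

lemma power2_norm_add_scaleR:
  fixes x y :: "'a::real_inner"
  shows "(norm (x + \<mu> *\<^sub>R y))\<^sup>2 + (norm y)\<^sup>2 = (norm x)\<^sup>2 + 2 * \<mu> * (x \<bullet> y) + (1 + \<mu>\<^sup>2) * (norm y)\<^sup>2"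
  unfolding power2_norm_eq_inner
  by (simp add: inner_add_left inner_add_right inner_commute[of y x] power2_eq_square algebra_simps)

section \<open>From operator norms to the disk inequality\<close>

lemma opnorm_Delta_at_eigen_tuple_le:
  fixes z w :: "complex^'d" and \<Delta> :: "complex^'d \<Rightarrow> complex^'r^'s"
  assumes "z \<noteq> w" "opnorm (\<Delta> z) < 1" "opnorm (\<Delta> w) < 1"
    and t: "(1 + \<mu>\<^sup>2) * t\<^sup>2 = 1" "0 \<le> t" "t = 1 \<or> d_Delta \<Delta> z w \<le> t"
  shows "opnorm (Delta_at \<Delta> (eigen_tuple \<mu> z w)) \<le> 1"
  unfolding opnorm_def Delta_at_eigen_tuple[OF assms(1)]
proof (rule onorm_le)
  fix x :: "complex^('r \<times> 2)"
  let ?X = "eigen_block \<mu> (\<Delta> z) (\<Delta> w)"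
  define v where "v = slice 2 x"
  define u where "u = slice 1 x - \<mu> *\<^sub>R v"
  have "(norm (?X *v x))\<^sup>2 = (norm (\<Delta> z *v u + \<mu> *\<^sub>R (\<Delta> w *v v)))\<^sup>2 + (norm (\<Delta> w *v v))\<^sup>2"
    by (simp add: norm_slices slice_eigen_block u_def v_def)
  also have "\<dots> \<le> (norm u)\<^sup>2 + 2 * \<mu> * (u \<bullet> v) + (1 + \<mu>\<^sup>2) * (norm v)\<^sup>2"
    unfolding power2_norm_add_scaleR by (rule d_Delta_contraction) (use assms in auto)
  also have "\<dots> = (norm (u + \<mu> *\<^sub>R v))\<^sup>2 + (norm v)\<^sup>2"
    by (simp only: power2_norm_add_scaleR)
  also have "\<dots> = (norm x)\<^sup>2"
    by (simp add: norm_slices[of x] u_def v_def)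
  finally have "norm (?X *v x) \<le> norm x"
    by (rule power2_le_imp_le) simp
  then show "norm (?X *v x) \<le> 1 * norm x"
    by simp
qed

lemma disk_contraction_of_opnorm_fun_at:
  fixes z w :: "complex^'d"
  assumes "z \<noteq> w" and f: "opnorm (fun_at f (eigen_tuple \<mu> z w)) \<le> 1"
  shows "(1 + \<mu>\<^sup>2) * (cmod (f z - f w))\<^sup>2 \<le> (cmod (1 - cnj (f w) * f z))\<^sup>2"
proof (rule disk_contraction_det)
  fix \<alpha> \<beta> :: complex
  let ?F = "eigen_mat \<mu> (f z) (f w)"
  \<comment> \<open>The vector with coefficients \<open>\<alpha>\<close>, \<open>\<beta>\<close> in
    the eigenvector basis.\<close>
  define x :: "complex^2" where "x = vector [\<alpha> + \<mu> *\<^sub>R \<beta>, \<beta>]"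
  have norm2: "(norm y)\<^sup>2 = (norm (y $ 1))\<^sup>2 + (norm (y $ 2))\<^sup>2" for y :: "complex^2"
    by (simp add: power2_norm_eq_inner inner_vec_def sum_2)
  have "(cmod (f z * \<alpha>))\<^sup>2 + 2 * \<mu> * ((f z * \<alpha>) \<bullet> (f w * \<beta>)) + (1 + \<mu>\<^sup>2) * (cmod (f w * \<beta>))\<^sup>2
      = (norm (?F *v x))\<^sup>2"
    by (simp add: norm2 eigen_mat_vector x_def scaleR_conv_of_real[where 'a=complex] flip: power2_norm_add_scaleR)
  also have "\<dots> \<le> (norm x)\<^sup>2"
  proof (rule power_mono)
    have "norm (?F *v x) \<le> opnorm ?F * norm x"
      by (rule norm_matrix_vector_le)
    also have "\<dots> \<le> 1 * norm x"
      using f by (intro mult_right_mono) (simp_all add: fun_at_eigen_tuple[OF assms(1)])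
    finally show "norm (?F *v x) \<le> norm x" by simp
  qed simp
  also have "\<dots> = (cmod \<alpha>)\<^sup>2 + 2 * \<mu> * (\<alpha> \<bullet> \<beta>) + (1 + \<mu>\<^sup>2) * (cmod \<beta>)\<^sup>2"
    by (simp add: norm2 x_def flip: power2_norm_add_scaleR)
  finally show "(cmod (f z * \<alpha>))\<^sup>2 + 2 * \<mu> * ((f z * \<alpha>) \<bullet> (f w * \<beta>)) + (1 + \<mu>\<^sup>2) * (cmod (f w * \<beta>))\<^sup>2
      \<le> (cmod \<alpha>)\<^sup>2 + 2 * \<mu> * (\<alpha> \<bullet> \<beta>) + (1 + \<mu>\<^sup>2) * (cmod \<beta>)\<^sup>2" .
qed

lemma d_disk_le:
  fixes z w :: "complex^'d" and \<Delta> :: "complex^'d \<Rightarrow> complex^'r^'s"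
  assumes "z \<noteq> w" "f \<in> S2_gen E \<Delta>" "z \<in> B_Delta E \<Delta>" "w \<in> B_Delta E \<Delta>"
    and t: "0 < t" "t \<le> 1" "t = 1 \<or> d_Delta \<Delta> z w \<le> t"
  shows "d_disk (f z) (f w) \<le> t"
proof -
  \<comment> \<open>Solves \<open>(1 + \<mu>\<^sup>2) * t\<^sup>2 = 1\<close>; the radicand is
    nonnegative because \<open>t \<le> 1\<close>.\<close>
  define \<mu> where "\<mu> = sqrt (1 / t\<^sup>2 - 1)"
  have "t\<^sup>2 \<le> 1"
    using t by (simp add: power_le_one)
  then have "\<mu>\<^sup>2 = 1 / t\<^sup>2 - 1"
    using t by (simp add: \<mu>_def)
  then have \<mu>: "(1 + \<mu>\<^sup>2) * t\<^sup>2 = 1"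
    using t by simp
  let ?T = "eigen_tuple \<mu> z w"
  have "opnorm (Delta_at \<Delta> ?T) \<le> 1"
    by (rule opnorm_Delta_at_eigen_tuple_le[OF _ _ _ \<mu>])
      (use assms in \<open>auto simp: B_Delta_def\<close>)
  moreover have "joint_spectrum ?T \<subseteq> B_Delta E \<Delta>"
    using joint_spectrum_eigen_tuple[OF assms(1)] assms(3,4) by blast
  ultimately have "opnorm (fun_at f ?T) \<le> 1"
    using assms(2) generic_eigen_tuple[OF assms(1)] by (auto simp: S2_gen_def)
  then have "t\<^sup>2 * ((1 + \<mu>\<^sup>2) * (cmod (f z - f w))\<^sup>2) \<le> t\<^sup>2 * (cmod (1 - cnj (f w) * f z))\<^sup>2"
    using disk_contraction_of_opnorm_fun_at[OF assms(1)] by (intro mult_left_mono) auto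
  also have "t\<^sup>2 * ((1 + \<mu>\<^sup>2) * (cmod (f z - f w))\<^sup>2) = (cmod (f z - f w))\<^sup>2"
    using \<mu> by (metis mult.assoc mult.commute mult_1)
  finally have "(cmod (f z - f w))\<^sup>2 \<le> (t * cmod (1 - cnj (f w) * f z))\<^sup>2"
    by (simp add: power_mult_distrib)
  then have "cmod (f z - f w) \<le> t * cmod (1 - cnj (f w) * f z)"
    using t by (auto intro: power2_le_imp_le)
  then have "cmod ((f z - f w) / (1 - cnj (f w) * f z)) \<le> t"
    \<comment> \<open>A zero denominator makes the quotient \<open>0\<close>, which is below
      \<open>t\<close>.\<close>
    using t by (cases "1 - cnj (f w) * f z = 0") (simp_all add: norm_divide divide_le_eq)
  then show ?thesis
    using t by (simp add: d_disk_def)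
qed

theorem corollary4p2:
  fixes E :: "(complex^'d) set"
    and \<Delta> :: "complex^'d \<Rightarrow> complex^'r^'s"
    and f :: "complex^'d \<Rightarrow> complex"
    and z w :: "complex^'d"
  assumes "\<exists>x\<in>B_Delta E \<Delta>. \<exists>y\<in>B_Delta E \<Delta>. x \<noteq> y"
    and "f \<in> S2_gen E \<Delta>"
    and "z \<in> B_Delta E \<Delta>"
    and "w \<in> B_Delta E \<Delta>"
  shows "d_disk (f z) (f w) \<le> d_Delta \<Delta> z w"
proof (cases "z = w")
  case True
  then show ?thesis
    by (simp add: d_disk_def d_Delta_def opnorm_nonneg)
next
  case False
  have le: "d_disk (f z) (f w) \<le> t" if "0 < t" "t \<le> 1" "t = 1 \<or> d_Delta \<Delta> z w \<le> t" for t
    by (rule d_disk_le[OF False assms(2-4) that])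
  have nonneg: "0 \<le> d_Delta \<Delta> z w"
    by (simp add: d_Delta_def opnorm_nonneg)
  show ?thesis
  proof (cases "d_Delta \<Delta> z w < 1")
    case True
    then show ?thesis
    \<comment> \<open>Approaching from strictly above keeps \<open>t\<close> positive even if
      \<open>d_Delta \<Delta> z w = 0\<close>.\<close>
    proof (rule dense_ge_bounded)
      fix t assume "d_Delta \<Delta> z w < t" "t < 1"
      then show "d_disk (f z) (f w) \<le> t"
        using le[of t] nonneg by simp
    qed
  next
    case False
    then show ?thesis
      using le[of 1] by simp
  qed
qed

end
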